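(* Let $m\ge1$, let $T\subseteq\{0,\ldots,m-1\}$, $s=|T|$, and consider the Frobenius-factorized reduction algorithm modulo $g=x^m+\sum_{t\in T}x^t\in\mathbb{F}_2[x]$, with the quantities $r$, $h_k$, $\ell_t$, $S_{\mathrm{fb}}$, $W_{\mathrm{fb}}$, $W_V$ defined in the context. The number $S_{\mathrm{fb}}$ of stored feedback shifts and the feedback contribution work $W_{\mathrm{fb}}$ are, respectively, $$S_{\mathrm{fb}}=\sum_{k=0}^{r-1}h_k=\sum_{t\in T}\ell_t,$$ $$W_{\mathrm{fb}}=\sum_{t\in T}\sum_{k\ge0}[m-2^k\Delta_t]_+,\qquad [z]_+=\max\{z,0\}.$$ The final low-part assembly has scheduled coefficient work $$W_V=\sum_{t\in T}(m-t)=\sum_{t\in T}\Delta_t.$$ If $s\ge1$, then $$S_{\mathrm{fb}}\le s+\log_2\frac{m^s}{s!}\le s\left(1+\log_2\frac{em}{s}\right),$$ $$W_{\mathrm{fb}}\le mS_{\mathrm{fb}}=O\!\left(ms\left(1+\log\frac{m}{s}\right)\right),$$ $$W_{\mathrm{fb}}+W_V=O\!\left(ms\left(1+\log\frac{m}{s}\right)\right).$$ The inequality $W_{\mathrm{fb}}\le mS_{\mathrm{fb}}$ is strict whenever $U\ne0$.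
   Context: For $t\in T$ put $\Delta_t=m-t$. For $d\ge 0$, $N^d$ is the truncated right shift on $\mathbb{F}_2^m$: $(N^dy)_i=y_{i+d}$ if $0\le i<m-d$ and $(N^dy)_i=0$ if $m-d\le i<m$; $N^d=0$ for $d\ge m$. Put $U=\sum_{t\in T}N^{\Delta_t}$ and $V(Y)=\sum_{t\in T}(x^tY\bmod x^m)$ for $\deg Y<m$ (polynomials of degree below $m$ are identified with vectors in $\mathbb{F}_2^m$; empty sums are zero). If $T\subseteq\{0\}$ (equivalently $U=0$) set $r=0$; otherwise $\Delta_{\min}=\min\{\Delta_t:t\in T\}$ and $r=\lceil\log_2(m/\Delta_{\min})\rceil$. For $k\ge0$ let $T_k=\{t\in T:2^k\Delta_t<m\}$, $h_k=|T_k|$, and for $t\in T$ let $\ell_t=\#\{k\ge0:2^k\Delta_t<m\}=\lceil\log_2(m/\Delta_t)\rceil$. Frobenius-factorized reduction algorithm on input $A=L+x^mH$ ($\deg L,\deg H<m$): set $Y\leftarrow H$; for $k=0,\ldots,r-1$ synchronously replace $Y$ by $Y+\sum_{t\in T_k}N^{2^k\Delta_t}Y$ (all shifts read the same stage input); return $L+V(Y)$. Scheduled coefficient contributions: adding one shifted source coefficient to one destination coefficient costs one unit; retaining the unshifted stage input, copying, testing bounds and reading schedule descriptors are not counted. A feedback shift by $d<m$ contributes to the destination positions $0\le i<m-d$ (from source position $i+d$); a low-assembly term $x^tY\bmod x^m$ contributes from the source positions $0\le i<m-t$ (to destination $i+t$). $S_{\mathrm{fb}}$ is the number of stored feedback shifts,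 i.e. of pairs $(k,t)$ with $0\le k<r$ and $t\in T_k$. $W_{\mathrm{fb}}$ is the total number of scheduled coefficient contributions in all feedback stages $k=0,\ldots,r-1$, and $W_V$ is the number of scheduled coefficient contributions in the evaluation of $V(Y)$ in the final assembly. The implied constants in $O(\cdot)$ are absolute; $e$ is the base of the natural logarithm. *)

theory Defs
  imports Complex_Main "HOL-Library.Z2" "HOL-Computational_Algebra.Polynomial"
begin

text \<open>
  The field with two elements is \<^typ>\<open>bit\<close>. A vector in its m-th power is identified with a
  polynomial of degree below \<open>m\<close>; coordinate \<open>i\<close> is the coefficient of \<open>x^i\<close>.
  A modulus \<open>g\<close> is represented by \<open>m\<close> and the set \<open>T \<subseteq> {0..<m}\<close> of its lower exponents.
\<close>

definition modulus :: "nat \<Rightarrow> nat set \<Rightarrow> bit poly" where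
  "modulus m T = monom 1 m + (\<Sum>t\<in>T. monom 1 t)"

definition Delta :: "nat \<Rightarrow> nat \<Rightarrow> nat" where
  "Delta m t = m - t"

definition shiftN :: "nat \<Rightarrow> nat \<Rightarrow> bit poly \<Rightarrow> bit poly" where
  "shiftN m d Y = poly_cutoff (m - d) (poly_shift d Y)"

lemma coeff_shiftN:
  "coeff (shiftN m d Y) i = (if i < m - d then coeff Y (i + d) else 0)"
  by (simp add: shiftN_def coeff_poly_cutoff coeff_poly_shift)

definition opU :: "nat \<Rightarrow> nat set \<Rightarrow> bit poly \<Rightarrow> bit poly" where
  "opU m T Y = (\<Sum>t\<in>T. shiftN m (Delta m t) Y)"

definition opV :: "nat \<Rightarrow> nat set \<Rightarrow> bit poly \<Rightarrow> bit poly" where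
  "opV m T Y = (\<Sum>t\<in>T. (monom 1 t * Y) mod monom 1 m)"

definition num_stages :: "nat \<Rightarrow> nat set \<Rightarrow> nat" where
  "num_stages m T =
     (if T \<subseteq> {0} then 0
      else nat \<lceil>log 2 (real m / real (Min (Delta m ` T)))\<rceil>)"

definition active :: "nat \<Rightarrow> nat set \<Rightarrow> nat \<Rightarrow> nat set" where
  "active m T k = {t \<in> T. 2 ^ k * Delta m t < m}"

definition h :: "nat \<Rightarrow> nat set \<Rightarrow> nat \<Rightarrow> nat" where
  "h m T k = card (active m T k)"

definition ell :: "nat \<Rightarrow> nat \<Rightarrow> nat" where
  "ell m t = card {k. 2 ^ k * Delta m t < m}"

lemma two_pow_less_iff:
  assumes "t < m"
  shows "2 ^ k * Delta m t < m \<longleftrightarrow> k < nat \<lceil>log 2 (real m / real (Delta m t))\<rceil>"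
proof -
  let ?d = "Delta m t" and ?x = "log 2 (real m / real (Delta m t))"
  have pos: "0 < real ?d" "0 < real m" using assms by (auto simp: Delta_def)
  have "2 ^ k * ?d < m \<longleftrightarrow> real (2 ^ k * ?d) < real m"
    by (rule of_nat_less_iff [symmetric])
  also have "\<dots> \<longleftrightarrow> 2 powr real k < real m / real ?d"
    using pos by (simp add: powr_realpow field_simps)
  also have "\<dots> \<longleftrightarrow> real k < ?x"
    using pos by (simp add: less_log_iff)
  also have "\<dots> \<longleftrightarrow> k < nat \<lceil>?x\<rceil>"
    by linarith
  finally show ?thesis .
qed

lemma ell_eq_ceiling_log:
  assumes "t < m"
  shows "ell m t = nat \<lceil>log 2 (real m / real (Delta m t))\<rceil>"
  using two_pow_less_iff [OF assms] by (simp add: ell_def flip: lessThan_def)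

definition feedback_stage :: "nat \<Rightarrow> nat set \<Rightarrow> nat \<Rightarrow> bit poly \<Rightarrow> bit poly" where
  "feedback_stage m T k Y = Y + (\<Sum>t\<in>active m T k. shiftN m (2 ^ k * Delta m t) Y)"

definition frobenius_reduce :: "nat \<Rightarrow> nat set \<Rightarrow> bit poly \<Rightarrow> bit poly" where
  "frobenius_reduce m T A =
     (let L = A mod monom 1 m; H = A div monom 1 m;
          Y = fold (feedback_stage m T) [0..<num_stages m T] H
      in L + opV m T Y)"

text \<open>
  The schedule. A feedback contribution \<open>(k, t, i)\<close> adds, in stage \<open>k\<close>, the source coefficient at
  \<open>i + 2^k \<Delta>\<^sub>t\<close> to the destination \<open>i\<close>. An assembly contribution \<open>(t, i)\<close> adds the source
  coefficient at \<open>i\<close> to the destination \<open>i + t\<close>. Each contribution costs one unit, whatever the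
  values of the coefficients; retaining the unshifted stage input is free.
\<close>

definition stage_contribs :: "nat \<Rightarrow> nat set \<Rightarrow> nat \<Rightarrow> (nat \<times> nat) set" where
  "stage_contribs m T k = (SIGMA t:active m T k. {0..<m - 2 ^ k * Delta m t})"

definition feedback_contribs :: "nat \<Rightarrow> nat set \<Rightarrow> (nat \<times> nat \<times> nat) set" where
  "feedback_contribs m T = (SIGMA k:{0..<num_stages m T}. stage_contribs m T k)"

definition assembly_contribs :: "nat \<Rightarrow> nat set \<Rightarrow> (nat \<times> nat) set" where
  "assembly_contribs m T = (SIGMA t:T. {0..<m - t})"

definition S_fb :: "nat \<Rightarrow> nat set \<Rightarrow> nat" where
  "S_fb m T = card (SIGMA k:{0..<num_stages m T}. active m T k)"

definition W_fb :: "nat \<Rightarrow> nat set \<Rightarrow> nat" where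
  "W_fb m T = card (feedback_contribs m T)"

definition W_V :: "nat \<Rightarrow> nat set \<Rightarrow> nat" where
  "W_V m T = card (assembly_contribs m T)"

text \<open>The algorithm performs exactly the scheduled contributions.\<close>

lemma shiftN_contribs:
  "shiftN m d Y = (\<Sum>i\<in>{0..<m - d}. monom (coeff Y (i + d)) i)"
  by (rule poly_eqI) (simp add: coeff_shiftN coeff_sum)

lemma feedback_stage_contribs:
  assumes "finite T"
  shows "feedback_stage m T k Y =
    Y + (\<Sum>(t, i)\<in>stage_contribs m T k. monom (coeff Y (i + 2 ^ k * Delta m t)) i)"
proof -
  have "finite (active m T k)" using assms by (simp add: active_def)
  then show ?thesis
    by (simp add: feedback_stage_def stage_contribs_def shiftN_contribs sum.Sigma)
qed

lemma mod_monom_eq_poly_cutoff: "(p :: bit poly) mod monom 1 m = poly_cutoff m p"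
proof -
  have split: "p = poly_shift m p * monom 1 m + poly_cutoff m p"
    by (rule poly_eqI)
       (auto simp: coeff_poly_cutoff coeff_poly_shift mult.commute [of _ "monom 1 m"]
         coeff_monom_mult)
  have "degree (poly_cutoff m p) < degree (monom (1::bit) m) \<or> poly_cutoff m p = 0"
  proof (cases "m = 0")
    case False
    then have "degree (poly_cutoff m p) \<le> m - 1"
      by (intro degree_le) (auto simp: coeff_poly_cutoff)
    with False have "degree (poly_cutoff m p) < m" by linarith
    then show ?thesis by (simp add: degree_monom_eq)
  qed (simp add: poly_eq_iff coeff_poly_cutoff)
  then have "poly_cutoff m p mod monom 1 m = poly_cutoff m p"
    using mod_poly_less by auto
  then show ?thesis by (subst split) simp
qed

lemma opV_contribs:
  assumes "finite T"
  shows "opV m T Y = (\<Sum>(t, i)\<in>assembly_contribs m T. monom (coeff Y i) (i + t))"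
proof -
  have "(monom 1 t * Y) mod monom 1 m = (\<Sum>i\<in>{0..<m - t}. monom (coeff Y i) (i + t))" for t
  proof (rule poly_eqI)
    fix n
    have "(\<Sum>i\<in>{0..<m - t}. if i + t = n then coeff Y i else 0) =
        (\<Sum>i\<in>{0..<m - t}. if i = n - t then if t \<le> n then coeff Y i else 0 else 0)"
      by (rule sum.cong) auto
    then show "coeff ((monom 1 t * Y) mod monom 1 m) n =
        coeff (\<Sum>i\<in>{0..<m - t}. monom (coeff Y i) (i + t)) n"
      by (auto simp: mod_monom_eq_poly_cutoff coeff_poly_cutoff coeff_monom_mult coeff_sum)
  qed
  with assms show ?thesis by (simp add: opV_def assembly_contribs_def sum.Sigma)
qed

text \<open>
  The algorithm computes the remainder modulo \<open>g\<close>. The feedback operators of successive stages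
  are squares of each other, because cross terms cancel in characteristic two.
\<close>

lemma bit_poly_double: "(p :: bit poly) + p = 0"
proof (rule poly_eqI)
  fix n show "coeff (p + p) n = coeff 0 n"
    by (cases "coeff p n") (simp_all only: coeff_add coeff_0, simp_all)
qed

lemma sum_sym_char2:
  fixes f :: "'a \<Rightarrow> 'a \<Rightarrow> bit poly"
  assumes "finite T" "\<And>a b. f a b = f b a"
  shows "(\<Sum>a\<in>T. \<Sum>b\<in>T. f a b) = (\<Sum>a\<in>T. f a a)"
  using assms(1)
proof (induction T)
  case (insert c F)
  have "(\<Sum>a\<in>insert c F. \<Sum>b\<in>insert c F. f a b) =
      f c c + ((\<Sum>b\<in>F. f c b) + (\<Sum>a\<in>F. f a c)) + (\<Sum>a\<in>F. \<Sum>b\<in>F. f a b)"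
    using insert.hyps by (simp add: sum.distrib algebra_simps)
  also have "(\<Sum>b\<in>F. f c b) + (\<Sum>a\<in>F. f a c) = 0"
    using bit_poly_double by (simp add: assms(2) [of _ c])
  finally show ?case using insert by simp
qed simp

lemma shiftN_add: "shiftN m d (Y + Z) = shiftN m d Y + shiftN m d Z"
  by (rule poly_eqI) (simp add: coeff_shiftN)

lemma shiftN_sum: "shiftN m d (sum f A) = (\<Sum>a\<in>A. shiftN m d (f a))"
  by (rule poly_eqI) (simp add: coeff_shiftN coeff_sum)

lemma shiftN_shiftN: "shiftN m a (shiftN m b Y) = shiftN m (a + b) Y"
  by (rule poly_eqI) (auto simp: coeff_shiftN algebra_simps)

lemma shiftN_eq_0: "m \<le> d \<Longrightarrow> shiftN m d Y = 0"
  by (rule poly_eqI) (simp add: coeff_shiftN)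

definition opU_pow2 :: "nat \<Rightarrow> nat set \<Rightarrow> nat \<Rightarrow> bit poly \<Rightarrow> bit poly" where
  "opU_pow2 m T k Y = (\<Sum>t\<in>T. shiftN m (2 ^ k * Delta m t) Y)"

lemma opU_pow2_add: "opU_pow2 m T k (Y + Z) = opU_pow2 m T k Y + opU_pow2 m T k Z"
  by (simp add: opU_pow2_def shiftN_add sum.distrib)

lemma opU_pow2_0: "opU_pow2 m T 0 Y = opU m T Y"
  by (simp add: opU_pow2_def opU_def)

lemma opU_pow2_commute:
  "opU_pow2 m T j (opU_pow2 m T k Y) = opU_pow2 m T k (opU_pow2 m T j Y)"
  unfolding opU_pow2_def shiftN_sum shiftN_shiftN
  by (subst sum.swap) (simp add: add.commute)

lemma opU_pow2_Suc:
  assumes "finite T"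
  shows "opU_pow2 m T (Suc k) Y = opU_pow2 m T k (opU_pow2 m T k Y)"
  unfolding opU_pow2_def shiftN_sum shiftN_shiftN
  by (subst sum_sym_char2 [OF assms]) (simp_all add: add.commute flip: mult_2 mult.assoc)

lemma feedback_stage_eq:
  assumes "finite T"
  shows "feedback_stage m T k Y = Y + opU_pow2 m T k Y"
proof -
  have "(\<Sum>t\<in>active m T k. shiftN m (2 ^ k * Delta m t) Y) = opU_pow2 m T k Y"
    unfolding opU_pow2_def using assms
    by (intro sum.mono_neutral_left) (auto simp: active_def intro: shiftN_eq_0)
  then show ?thesis by (simp add: feedback_stage_def)
qed

lemma opU_pow2_num_stages:
  assumes "T \<subseteq> {0..<m}"
  shows "opU_pow2 m T (num_stages m T) Y = 0"
  unfolding opU_pow2_def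
proof (rule sum.neutral, rule ballI, rule shiftN_eq_0, rule ccontr)
  fix t assume t: "t \<in> T" and "\<not> m \<le> 2 ^ num_stages m T * Delta m t"
  then have less: "2 ^ num_stages m T * Delta m t < m" by simp
  have fin: "finite T" using assms finite_subset by blast
  have nz: "\<not> T \<subseteq> {0}"
  proof
    assume "T \<subseteq> {0}"
    with t less show False by (auto simp: num_stages_def Delta_def)
  qed
  let ?D = "Min (Delta m ` T)"
  have "?D \<in> Delta m ` T" using fin t by (intro Min_in) auto
  then obtain u where u: "u \<in> T" "?D = Delta m u" by auto
  have um: "u < m" using u assms by auto
  have "Delta m u \<le> Delta m t" using fin t u(2) [symmetric] by simp
  then have "2 ^ num_stages m T * Delta m u \<le> 2 ^ num_stages m T * Delta m t" by simp
  with less have "2 ^ num_stages m T * Delta m u < m" by linarith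
  moreover have "num_stages m T = nat \<lceil>log 2 (real m / real (Delta m u))\<rceil>"
    using nz u by (simp add: num_stages_def)
  ultimately show False using two_pow_less_iff [OF um] by simp
qed

lemma feedback_fold:
  assumes "finite T"
  shows "fold (feedback_stage m T) [0..<k] H + opU m T (fold (feedback_stage m T) [0..<k] H) =
    H + opU_pow2 m T k H"
proof (induction k)
  case 0
  then show ?case by (simp add: opU_pow2_0)
next
  case (Suc k)
  let ?Y = "fold (feedback_stage m T) [0..<k] H" and ?P = "opU_pow2 m T"
  have "(?Y + ?P k ?Y) + ?P 0 (?Y + ?P k ?Y) =
      (?Y + ?P 0 ?Y) + ?P k (?Y + ?P 0 ?Y)"
    by (simp add: opU_pow2_add opU_pow2_commute [of m T 0 k] algebra_simps)
  also have "\<dots> = (H + ?P k H) + ?P k (H + ?P k H)"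
    using Suc.IH by (simp add: opU_pow2_0)
  also have "\<dots> = H + (?P k H + ?P k H) + ?P k (?P k H)"
    by (simp add: opU_pow2_add algebra_simps)
  also have "\<dots> = H + ?P (Suc k) H"
    by (simp add: bit_poly_double opU_pow2_Suc [OF assms])
  finally show ?case using feedback_stage_eq [OF assms, of m k ?Y] by (simp add: opU_pow2_0)
qed

lemma monom_mult_split:
  assumes "t < m" "degree Y < m"
  shows "monom 1 t * Y =
    (monom 1 t * Y) mod monom 1 m + monom 1 m * shiftN m (Delta m t) Y"
  using assms
  by (intro poly_eqI)
     (auto simp: mod_monom_eq_poly_cutoff coeff_poly_cutoff coeff_monom_mult coeff_shiftN
       Delta_def intro!: coeff_eq_0)

lemma degree_feedback_fold:
  assumes "finite T" "degree H < m"
  shows "degree (fold (feedback_stage m T) [0..<k] H) < m"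
proof (induction k)
  case (Suc k)
  let ?Y = "fold (feedback_stage m T) [0..<k] H"
  have "degree (?Y + opU_pow2 m T k ?Y) \<le> m - 1"
    using Suc.IH
    by (intro degree_le)
       (auto simp: opU_pow2_def coeff_sum coeff_shiftN coeff_eq_0 intro!: sum.neutral)
  with assms(2) show ?case using feedback_stage_eq [OF assms(1), of m k ?Y] by simp
qed (use assms in simp)

theorem frobenius_reduce_correct:
  assumes "1 \<le> m" "T \<subseteq> {0..<m}" "degree A < 2 * m"
  shows "frobenius_reduce m T A = A mod modulus m T"
proof -
  define L where "L = A mod monom 1 m"
  define H where "H = A div monom 1 m"
  define Y where "Y = fold (feedback_stage m T) [0..<num_stages m T] H"
  have fin: "finite T" using assms(2) finite_subset by blast
  have A: "A = L + monom 1 m * H" by (simp add: L_def H_def)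
  have "degree H < m"
  proof -
    have "coeff H i = 0" if "i > m - 1" for i
    proof -
      have "coeff A (i + m) = 0" using that assms by (intro coeff_eq_0) linarith
      moreover have "coeff L (i + m) = 0"
        by (simp add: L_def mod_monom_eq_poly_cutoff coeff_poly_cutoff)
      ultimately show ?thesis using arg_cong [OF A, of "\<lambda>p. coeff p (i + m)"]
        by (simp add: coeff_monom_mult)
    qed
    then have "degree H \<le> m - 1" by (intro degree_le) simp
    with assms(1) show ?thesis by linarith
  qed
  then have dY: "degree Y < m" unfolding Y_def by (rule degree_feedback_fold [OF fin])
  have H: "Y + opU m T Y = H"
    using feedback_fold [OF fin, of m "num_stages m T" H] opU_pow2_num_stages [OF assms(2)]
    by (simp add: Y_def)
  have "(\<Sum>t\<in>T. monom 1 t * Y) =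
      (\<Sum>t\<in>T. (monom 1 t * Y) mod monom 1 m + monom 1 m * shiftN m (Delta m t) Y)"
    using assms(2) dY by (intro sum.cong monom_mult_split) auto
  then have "modulus m T * Y = monom 1 m * (Y + opU m T Y) + opV m T Y"
    by (simp add: modulus_def opU_def opV_def sum.distrib sum_distrib_left sum_distrib_right
        algebra_simps)
  then have gY: "modulus m T * Y = monom 1 m * H + opV m T Y" by (simp add: H)
  have eq: "A = modulus m T * Y + (L + opV m T Y)"
    using gY A bit_poly_double [of "opV m T Y"] by (simp add: algebra_simps)
  have dg: "degree (modulus m T) = m"
  proof -
    have "degree (\<Sum>t\<in>T. monom (1::bit) t) \<le> m - 1"
      using assms(2) by (intro degree_sum_le) (auto simp: fin degree_monom_eq)
    then have "degree (\<Sum>t\<in>T. monom (1::bit) t) < degree (monom (1::bit) m)"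
      using assms(1) by (simp add: degree_monom_eq)
    then show ?thesis by (simp add: modulus_def degree_add_eq_left degree_monom_eq)
  qed
  have "degree (L + opV m T Y) \<le> m - 1"
    by (intro degree_le)
       (auto simp: L_def opV_def mod_monom_eq_poly_cutoff coeff_poly_cutoff coeff_sum)
  then have "degree (L + opV m T Y) < degree (modulus m T)" using assms(1) dg by linarith
  then have "(L + opV m T Y) mod modulus m T = L + opV m T Y" by (rule mod_poly_less)
  then have "A mod modulus m T = L + opV m T Y" by (subst eq) simp
  then show ?thesis by (simp add: frobenius_reduce_def L_def H_def Y_def Let_def)
qed

end

theory Submission
  imports Defs
begin

text \<open>
  The gaps \<open>\<Delta>\<^sub>t\<close> are distinct positive integers, so their product is at least \<open>s!\<close>. Summing
  \<open>\<ell>\<^sub>t \<le> 1 + log\<^sub>2 (m / \<Delta>\<^sub>t)\<close> over \<open>t\<close> therefore bounds the number of stored shifts by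
  \<open>s + log\<^sub>2 (m^s / s!)\<close>, and \<open>s! \<ge> (s / e)^s\<close> gives the closed form. A feedback shift by \<open>d\<close>
  costs \<open>m - d < m\<close> contributions, since \<open>d \<ge> \<Delta>\<^sub>t > 0\<close>.
\<close>

section \<open>Factorial and exponential estimates\<close>

text \<open>Induction on the cardinality, removing the maximum \<open>M\<close>: a set of positive
  integers lies in \<open>{1..M}\<close>, so \<open>card A \<le> M\<close>, and the remaining
  elements supply the smaller factorial.\<close>

lemma fact_card_le_prod:
  assumes "finite A" "0 \<notin> A"
  shows "fact (card A) \<le> \<Prod>(A :: nat set)"
  using assms
proof (induction "card A" arbitrary: A)
  case (Suc n)
  define M where "M = Max A"
  have ne: "A \<noteq> {}" using Suc.hyps(2) by auto
  have M: "M \<in> A" using Suc.prems(1) ne by (simp add: M_def)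
  have "A \<subseteq> {1..M}"
  proof
    fix x assume "x \<in> A"
    moreover from this have "0 < x" using Suc.prems(2) by (metis gr0I)
    ultimately show "x \<in> {1..M}" using Suc.prems(1) by (simp add: M_def Suc_le_eq)
  qed
  then have le: "card A \<le> M" using card_mono [of "{1..M}" A] by simp
  have card: "card (A - {M}) = n" using Suc.hyps(2) Suc.prems(1) M by simp
  then have "fact n \<le> \<Prod>(A - {M})" using Suc.hyps(1) [of "A - {M}"] Suc.prems by simp
  with le have "card A * fact n \<le> M * \<Prod>(A - {M})" by (rule mult_le_mono)
  also have "\<dots> = \<Prod>A" using Suc.prems(1) M by (simp add: prod.remove)
  finally show ?case by (simp add: Suc.hyps(2) [symmetric])
qed simp

text \<open>The left side is a single term of the exponential series, whose terms are all
  nonnegative.\<close>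

lemma power_div_fact_le_exp:
  assumes "0 \<le> (x :: real)"
  shows "x ^ n / fact n \<le> exp x"
proof -
  have "(\<Sum>k\<in>{n}. inverse (fact k) *\<^sub>R x ^ k) \<le> (\<Sum>k. inverse (fact k) *\<^sub>R x ^ k)"
    using assms by (intro sum_le_suminf summable_exp_generic) auto
  then show ?thesis by (simp add: exp_def divide_inverse mult.commute)
qed

section \<open>Gaps and the range of active stages\<close>

lemma Delta_pos: "t < m \<Longrightarrow> 0 < Delta m t"
  by (simp add: Delta_def)

lemma inj_on_Delta: "T \<subseteq> {0..<m} \<Longrightarrow> inj_on (Delta m) T"
  by (rule inj_onI) (fastforce simp: Delta_def dest: subsetD)

lemma finite_active: "finite T \<Longrightarrow> finite (active m T k)"
  by (simp add: active_def)

text \<open>An exponent active at \<open>k\<close> forces the one with the smallest gap to be active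
  too, and for that one \<open>two_pow_less_iff\<close> turns activity into
  \<open>k < num_stages m T\<close>. Counts over active pairs may therefore range over all
  \<open>k\<close>.\<close>

lemma pow2_Delta_less_imp_less_num_stages:
  assumes T: "T \<subseteq> {0..<m}" and t: "t \<in> T" and less: "2 ^ k * Delta m t < m"
  shows "k < num_stages m T"
proof -
  have fin: "finite T" using T finite_subset by blast
  \<comment> \<open>This excludes the default value 0 of \<open>num_stages\<close>: the exponent 0
    has gap \<open>m\<close>, which contradicts \<open>less\<close>.\<close>
  have nz: "\<not> T \<subseteq> {0}"
  proof
    assume "T \<subseteq> {0}"
    with t have "m \<le> Delta m t" by (auto simp: Delta_def)
    also have "\<dots> \<le> 2 ^ k * Delta m t" by simp
    finally show False using less by simp
  qed
  have "Min (Delta m ` T) \<in> Delta m ` T" using fin t by (intro Min_in) auto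
  then obtain u where u: "u \<in> T" "Min (Delta m ` T) = Delta m u" by auto
  have "Delta m u \<le> Delta m t" using fin t u(2) [symmetric] by simp
  then have "2 ^ k * Delta m u \<le> 2 ^ k * Delta m t" by simp
  with less have "2 ^ k * Delta m u < m" by linarith
  with two_pow_less_iff [of u m k] u T nz show ?thesis
    by (auto simp: num_stages_def)
qed

section \<open>Exact counts of shifts and contributions\<close>

lemma S_fb_eq_sum_h:
  assumes "finite T"
  shows "S_fb m T = (\<Sum>k = 0..<num_stages m T. h m T k)"
  using assms by (simp add: S_fb_def h_def finite_active card_SigmaI)

text \<open>Double counting of the active pairs \<open>(k, t)\<close>: by stages on the left, by
  exponents on the right.\<close>

lemma sum_h_eq_sum_ell:
  assumes "T \<subseteq> {0..<m}"
  shows "(\<Sum>k = 0..<num_stages m T. h m T k) = (\<Sum>t\<in>T. ell m t)"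
proof -
  have fin: "finite T" using assms finite_subset by blast
  have "(\<Sum>k = 0..<num_stages m T. h m T k) =
      (\<Sum>k = 0..<num_stages m T. \<Sum>t\<in>T. if 2 ^ k * Delta m t < m then 1 else 0)"
    using fin by (simp add: h_def active_def Int_def flip: sum.inter_filter)
  also have "\<dots> = (\<Sum>t\<in>T. \<Sum>k = 0..<num_stages m T. if 2 ^ k * Delta m t < m then 1 else 0)"
    by (rule sum.swap)
  also have "\<dots> = (\<Sum>t\<in>T. card {k \<in> {0..<num_stages m T}. 2 ^ k * Delta m t < m})"
    by (simp flip: sum.inter_filter)
  also have "\<dots> = (\<Sum>t\<in>T. ell m t)"
    unfolding ell_def using pow2_Delta_less_imp_less_num_stages [OF assms]
    by (intro sum.cong arg_cong [where f = card]) auto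
  finally show ?thesis .
qed

lemma W_fb_eq_sum:
  assumes "finite T"
  shows "W_fb m T =
    (\<Sum>k = 0..<num_stages m T. \<Sum>t\<in>active m T k. m - 2 ^ k * Delta m t)"
  using assms
  by (simp add: W_fb_def feedback_contribs_def stage_contribs_def finite_active card_SigmaI)

text \<open>Inactive pairs have weight zero, so the inner sum extends from
  \<open>active m T k\<close> to \<open>T\<close>. After the swap the weights vanish from
  \<open>num_stages m T\<close> onwards, so each series is a finite sum.\<close>

lemma W_fb_eq_suminf:
  assumes "T \<subseteq> {0..<m}"
  shows "real (W_fb m T) =
    (\<Sum>t\<in>T. \<Sum>k::nat. max (real m - 2 ^ k * real (Delta m t)) 0)"
proof -
  let ?r = "num_stages m T"
  let ?w = "\<lambda>k t. max (real m - 2 ^ k * real (Delta m t)) 0"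
  have fin: "finite T" using assms finite_subset by blast
  \<comment> \<open>Truncated subtraction on naturals is exactly the positive part.\<close>
  have w: "?w k t = real (m - 2 ^ k * Delta m t)" for k t
  proof (cases "2 ^ k * Delta m t \<le> m")
    case True
    then have "real (2 ^ k * Delta m t) \<le> real m" by (rule of_nat_mono)
    then show ?thesis using True by (simp add: of_nat_diff)
  next
    case False
    then have "real m \<le> real (2 ^ k * Delta m t)" by (intro of_nat_mono) simp
    then show ?thesis using False by simp
  qed
  have "real (W_fb m T) = (\<Sum>k = 0..<?r. \<Sum>t\<in>active m T k. ?w k t)"
    unfolding w using fin by (simp add: W_fb_eq_sum)
  also have "\<dots> = (\<Sum>k = 0..<?r. \<Sum>t\<in>T. ?w k t)"
    unfolding w using fin by (intro sum.cong refl sum.mono_neutral_left) (auto simp: active_def)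
  also have "\<dots> = (\<Sum>t\<in>T. \<Sum>k = 0..<?r. ?w k t)"
    by (rule sum.swap)
  also have "\<dots> = (\<Sum>t\<in>T. \<Sum>k. ?w k t)"
  proof (rule sum.cong [OF refl])
    fix t assume t: "t \<in> T"
    have "?w k t = 0" if "k \<notin> {0..<?r}" for k
    proof -
      have "\<not> 2 ^ k * Delta m t < m"
        using that pow2_Delta_less_imp_less_num_stages [OF assms t] by auto
      then show ?thesis unfolding w by simp
    qed
    then show "(\<Sum>k = 0..<?r. ?w k t) = (\<Sum>k. ?w k t)"
      by (intro suminf_finite [symmetric]) auto
  qed
  finally show ?thesis .
qed

lemma W_V_eq_sum: "finite T \<Longrightarrow> W_V m T = (\<Sum>t\<in>T. m - t)"
  by (simp add: W_V_def assembly_contribs_def card_SigmaI)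

section \<open>Upper bounds for the contribution work\<close>

lemma W_V_le: "finite T \<Longrightarrow> W_V m T \<le> m * card T"
  using sum_bounded_above [of T "\<lambda>t. m - t" m] by (simp add: W_V_eq_sum mult.commute)

text \<open>Puts \<open>m * S_fb m T\<close> over the same index set as \<open>W_fb_eq_sum\<close>,
  ready for termwise comparison.\<close>

lemma m_mult_S_fb:
  assumes "finite T"
  shows "m * S_fb m T = (\<Sum>k = 0..<num_stages m T. \<Sum>t\<in>active m T k. m)"
  using assms by (simp add: S_fb_eq_sum_h h_def sum_distrib_left mult.commute)

lemma W_fb_le: "finite T \<Longrightarrow> W_fb m T \<le> m * S_fb m T"
  unfolding W_fb_eq_sum m_mult_S_fb by (intro sum_mono) simp

text \<open>The exponent 0 has gap \<open>m\<close>, and a shift by \<open>m\<close> is zero, so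
  some other exponent must produce the nonzero value.\<close>

lemma opU_nonzero_imp:
  assumes "opU m T Y \<noteq> 0"
  obtains t where "t \<in> T" "0 < t"
proof -
  have "\<exists>t\<in>T. shiftN m (Delta m t) Y \<noteq> 0"
    using assms unfolding opU_def by (meson sum.neutral)
  then obtain t where t: "t \<in> T" "shiftN m (Delta m t) Y \<noteq> 0" by blast
  then have "0 < t" using shiftN_eq_0 [of m "Delta m t" Y] by (cases t) (auto simp: Delta_def)
  with t that show thesis by simp
qed

text \<open>One strict term suffices. A positive exponent is active at stage 0, so the loss there
  makes the whole double sum strictly smaller.\<close>

lemma W_fb_less:
  assumes T: "T \<subseteq> {0..<m}" and U: "opU m T Y \<noteq> 0"
  shows "W_fb m T < m * S_fb m T"
proof -
  have fin: "finite T" using T finite_subset by blast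
  obtain u where u: "u \<in> T" "0 < u" using opU_nonzero_imp [OF U] .
  have um: "u < m" using u T by auto
  have act: "u \<in> active m T 0" using u um by (simp add: active_def Delta_def)
  have stage: "0 < num_stages m T"
    using pow2_Delta_less_imp_less_num_stages [OF T u(1), of 0] act by (simp add: active_def)
  \<comment> \<open>The strict term is at \<open>u\<close>, where the left summand equals
    \<open>u < m\<close>.\<close>
  have "(\<Sum>t\<in>active m T 0. m - 2 ^ 0 * Delta m t) < (\<Sum>t\<in>active m T 0. m)"
    using um by (intro sum_strict_mono_ex1 finite_active fin) (auto intro!: bexI [OF _ act] simp: Delta_def)
  then show ?thesis
    unfolding W_fb_eq_sum [OF fin] m_mult_S_fb [OF fin] using stage
    by (intro sum_strict_mono_ex1 [where A = "{0..<num_stages m T}"] ballI sum_mono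
        bexI [where x = 0 and A = "{0..<num_stages m T}"]) auto
qed

section \<open>Logarithmic bounds on the number of shifts\<close>

lemma ell_le:
  assumes "t < m"
  shows "real (ell m t) \<le> 1 + log 2 (real m / real (Delta m t))"
proof -
  \<comment> \<open>Nonnegativity ensures that \<open>nat\<close> does not clip the ceiling.\<close>
  have "0 \<le> log 2 (real m / real (Delta m t))"
    using assms Delta_pos [OF assms] by (intro zero_le_log_cancel_iff [THEN iffD2])
      (auto simp: field_simps Delta_def)
  then show ?thesis unfolding ell_eq_ceiling_log [OF assms] by linarith
qed

lemma S_fb_le_log_fact:
  assumes m: "1 \<le> m" and T: "T \<subseteq> {0..<m}"
  shows "real (S_fb m T) \<le> real (card T) + log 2 (real m ^ card T / fact (card T))"
proof -
  have fin: "finite T" using T finite_subset by blast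
  have pos: "0 < Delta m t" "t < m" if "t \<in> T" for t
    using that T Delta_pos [of t m] by auto
  \<comment> \<open>Injectivity of \<open>Delta m\<close> makes the gaps a set of
    \<open>card T\<close> positive integers, to which \<open>fact_card_le_prod\<close>
    applies.\<close>
  have "fact (card T) = (fact (card (Delta m ` T)) :: nat)"
    by (simp add: card_image inj_on_Delta [OF T])
  also have "\<dots> \<le> \<Prod>(Delta m ` T)"
    using fin pos by (intro fact_card_le_prod) force+
  also have "\<dots> = (\<Prod>t\<in>T. Delta m t)"
    by (simp add: prod.reindex inj_on_Delta [OF T])
  finally have fact: "fact (card T) \<le> real (\<Prod>t\<in>T. Delta m t)"
    by (metis of_nat_fact of_nat_le_iff)
  have "real (S_fb m T) = (\<Sum>t\<in>T. real (ell m t))"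
    by (simp add: S_fb_eq_sum_h [OF fin] sum_h_eq_sum_ell [OF T])
  also have "\<dots> \<le> (\<Sum>t\<in>T. 1 + log 2 (real m / real (Delta m t)))"
    using pos by (intro sum_mono ell_le) auto
  also have "\<dots> = real (card T) + log 2 (\<Prod>t\<in>T. real m / real (Delta m t))"
    using m by (subst log_def, subst ln_prod [OF fin])
      (auto simp: log_def sum.distrib sum_divide_distrib dest: pos)
  also have "(\<Prod>t\<in>T. real m / real (Delta m t)) = real m ^ card T / real (\<Prod>t\<in>T. Delta m t)"
    by (simp add: prod_dividef)
  also have "log 2 \<dots> \<le> log 2 (real m ^ card T / fact (card T))"
    using m fact pos fin
    by (intro log_mono divide_left_mono divide_pos_pos mult_pos_pos)
       (auto intro!: prod_pos)
  finally show ?thesis by simp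
qed

lemma log_power_div_fact_le:
  assumes m: "1 \<le> m" and s: "1 \<le> s"
  shows "log 2 (real m ^ s / fact s) \<le> real s * log 2 (exp 1 * real m / real s)"
proof -
  \<comment> \<open>The choice \<open>x = s\<close> gives \<open>s! \<ge> (s / e)^s\<close>.\<close>
  have "real s ^ s / fact s \<le> exp (real s)" by (intro power_div_fact_le_exp) simp
  also have "exp (real s) = exp 1 ^ s" by (simp flip: exp_of_nat_mult)
  finally have "real m ^ s / fact s \<le> (exp 1 * real m / real s) ^ s"
    using s mult_left_mono [of "real s ^ s / fact s" "exp 1 ^ s" "real m ^ s"]
    by (simp add: field_simps power_mult_distrib power_divide)
  then have "log 2 (real m ^ s / fact s) \<le> log 2 ((exp 1 * real m / real s) ^ s)"
    using m by (intro log_mono) auto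
  also have "\<dots> = real s * log 2 (exp 1 * real m / real s)"
    using m s by (simp add: log_nat_power)
  finally show ?thesis .
qed

section \<open>Bounds with absolute constants\<close>

text \<open>In the constant, \<open>1 / ln 2\<close> comes from changing the base of the logarithm,
  and 1 from absorbing the summand \<open>card T\<close>.\<close>

lemma m_mult_S_fb_le_ln:
  assumes m: "1 \<le> m" and T: "T \<subseteq> {0..<m}" and s: "1 \<le> card T"
  shows "real (m * S_fb m T)
    \<le> (1 + 1 / ln 2) * (real m * real (card T) * (1 + ln (real m / real (card T))))"
proof -
  let ?s = "real (card T)" and ?l = "ln (real m / real (card T))"
  have "card T \<le> m" using card_mono [OF _ T] by simp
  then have l: "0 \<le> ?l" using s by (intro ln_ge_zero) (simp add: field_simps)
  have "log 2 (exp 1 * real m / ?s) = (1 + ?l) / ln 2"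
    using m s by (simp add: log_def ln_mult ln_div)
  then have "real (S_fb m T) \<le> ?s * (1 + (1 + ?l) / ln 2)"
    using S_fb_le_log_fact [OF m T] log_power_div_fact_le [OF m s] by (simp add: algebra_simps)
  \<comment> \<open>Since \<open>card T \<le> m\<close> gives \<open>0 \<le> ?l\<close>, the summand
    1 may grow to \<open>1 + ?l\<close>.\<close>
  also have "\<dots> \<le> ?s * ((1 + ?l) + (1 + ?l) / ln 2)"
    using l by (intro mult_left_mono) auto
  finally have "real m * real (S_fb m T) \<le> real m * (?s * ((1 + ?l) + (1 + ?l) / ln 2))"
    by (rule mult_left_mono) simp
  then show ?thesis by (simp add: algebra_simps add_divide_distrib)
qed

text \<open>The assembly work is at most \<open>m * card T\<close>, hence at most \<open>?B\<close>,
  which raises the previous constant by 1.\<close>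

lemma W_fb_add_W_V_le_ln:
  assumes m: "1 \<le> m" and T: "T \<subseteq> {0..<m}" and s: "1 \<le> card T"
  shows "real (W_fb m T + W_V m T)
    \<le> (2 + 1 / ln 2) * (real m * real (card T) * (1 + ln (real m / real (card T))))"
proof -
  let ?B = "real m * real (card T) * (1 + ln (real m / real (card T)))"
  have fin: "finite T" using T finite_subset by blast
  have "card T \<le> m" using card_mono [OF _ T] by simp
  then have "0 \<le> ln (real m / real (card T))" using s
    by (intro ln_ge_zero) (simp add: field_simps)
  then have "real m * real (card T) * 1 \<le> ?B" by (intro mult_left_mono) auto
  moreover have "real (W_V m T) \<le> real m * real (card T)"
    using W_V_le [OF fin, of m] by (metis of_nat_le_iff of_nat_mult)
  moreover have "real (W_fb m T) \<le> real (m * S_fb m T)"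
    using W_fb_le [OF fin] by (rule of_nat_mono)
  ultimately have "real (W_fb m T + W_V m T) \<le> (1 + 1 / ln 2) * ?B + ?B"
    using m_mult_S_fb_le_ln [OF m T s] by linarith
  also have "\<dots> = (2 + 1 / ln 2) * ?B" by (simp add: algebra_simps)
  finally show ?thesis .
qed

theorem theorem5p1:
  shows
    "(\<forall>(m::nat) (T::nat set). 1 \<le> m \<and> T \<subseteq> {0..<m} \<longrightarrow>
        S_fb m T = (\<Sum>k = 0..<num_stages m T. h m T k) \<and>
        (\<Sum>k = 0..<num_stages m T. h m T k) = (\<Sum>t\<in>T. ell m t) \<and>
        real (W_fb m T) =
          (\<Sum>t\<in>T. \<Sum>k::nat. max (real m - 2 ^ k * real (Delta m t)) 0) \<and>
        W_V m T = (\<Sum>t\<in>T. m - t) \<and>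
        (\<Sum>t\<in>T. m - t) = (\<Sum>t\<in>T. Delta m t) \<and>
        (1 \<le> card T \<longrightarrow>
          real (S_fb m T) \<le> real (card T) + log 2 (real m ^ card T / fact (card T)) \<and>
          real (card T) + log 2 (real m ^ card T / fact (card T))
            \<le> real (card T) * (1 + log 2 (exp 1 * real m / real (card T))) \<and>
          W_fb m T \<le> m * S_fb m T) \<and>
        ((\<exists>Y. degree Y < m \<and> opU m T Y \<noteq> 0) \<longrightarrow> W_fb m T < m * S_fb m T))
   \<and> (\<exists>C>0. \<forall>(m::nat) (T::nat set). 1 \<le> m \<and> T \<subseteq> {0..<m} \<and> 1 \<le> card T \<longrightarrow>
        real (m * S_fb m T)
          \<le> C * (real m * real (card T) * (1 + ln (real m / real (card T)))))
   \<and> (\<exists>C>0. \<forall>(m::nat) (T::nat set). 1 \<le> m \<and> T \<subseteq> {0..<m} \<and> 1 \<le> card T \<longrightarrow>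
        real (W_fb m T + W_V m T)
          \<le> C * (real m * real (card T) * (1 + ln (real m / real (card T)))))"
proof (intro conjI allI impI, goal_cases)
  case (1 m T)
  then show ?case using S_fb_eq_sum_h finite_subset by blast
next
  case (2 m T)
  then show ?case using sum_h_eq_sum_ell by blast
next
  case (3 m T)
  then show ?case using W_fb_eq_suminf by blast
next
  case (4 m T)
  then show ?case using W_V_eq_sum finite_subset by blast
next
  case (5 m T)
  then show ?case by (simp add: Delta_def)
next
  case (6 m T)
  then show ?case using S_fb_le_log_fact by blast
next
  case (7 m T)
  then show ?case using log_power_div_fact_le [of m "card T"] by (simp add: algebra_simps)
next
  case (8 m T)
  then show ?case using W_fb_le finite_subset by blast
next
  case (9 m T)
  then show ?case using W_fb_less by blast
next
  \<comment> \<open>The witness is independent of \<open>m\<close> and \<open>T\<close>. Together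
    with \<open>W_fb_le\<close> this also bounds \<open>W_fb\<close> itself.\<close>
  case 10
  have "0 < 1 + 1 / ln (2 :: real)" by (simp add: add_pos_pos)
  then show ?case using m_mult_S_fb_le_ln by blast
next
  case 11
  have "0 < 2 + 1 / ln (2 :: real)" by (simp add: add_pos_pos)
  then show ?case using W_fb_add_W_V_le_ln by blast
qed

end
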